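(* The theory of atomless Boolean algebras has ATP.
   Context: Boolean algebras are nontrivial ($0\neq 1$) and considered in the language $\{\wedge,\vee,0,1\}$, with the partial order $x\le y\Leftrightarrow x\wedge y=x$; atomless means that there are no minimal nonzero elements. For a complete theory $T$ with monster model $\mathbb{M}$, a formula $\varphi(x,y)$ has the antichain tree property (ATP) if there is a family $(a_\eta)_{\eta\in 2^{<\omega}}$ of parameters in $\mathbb{M}$ such that (i) for every antichain $X\subseteq 2^{<\omega}$ (set of elements pairwise incomparable for the initial segment order $\trianglelefteq$) the set $\{\varphi(x,a_\eta):\eta\in X\}$ is consistent, and (ii) $\{\varphi(x,a_\eta),\varphi(x,a_\nu)\}$ is inconsistent whenever $\eta\trianglelefteq\nu$ and $\eta\neq\nu$. $T$ has ATP if some formula has ATP in $T$. *)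

theory Defs
  imports Main "HOL-Library.Sublist"
begin

unbundle cardinal_syntax

section \<open>First-order logic in the language of meet, join, zero and one\<close>

datatype tm = Var nat | Zero | One | Meet tm tm | Join tm tm

datatype fm = Eq tm tm | Neg fm | Conj fm fm | Ex nat fm

abbreviation Disj :: "fm \<Rightarrow> fm \<Rightarrow> fm" where
  "Disj p q \<equiv> Neg (Conj (Neg p) (Neg q))"

abbreviation Imp :: "fm \<Rightarrow> fm \<Rightarrow> fm" where
  "Imp p q \<equiv> Disj (Neg p) q"

abbreviation All :: "nat \<Rightarrow> fm \<Rightarrow> fm" where
  "All v p \<equiv> Neg (Ex v (Neg p))"

abbreviation Le :: "tm \<Rightarrow> tm \<Rightarrow> fm" where
  "Le s t \<equiv> Eq (Meet s t) s"

fun vars :: "tm \<Rightarrow> nat set" where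
  "vars (Var v) = {v}"
| "vars Zero = {}"
| "vars One = {}"
| "vars (Meet s t) = vars s \<union> vars t"
| "vars (Join s t) = vars s \<union> vars t"

fun fv :: "fm \<Rightarrow> nat set" where
  "fv (Eq s t) = vars s \<union> vars t"
| "fv (Neg p) = fv p"
| "fv (Conj p q) = fv p \<union> fv q"
| "fv (Ex v p) = fv p - {v}"

record 'a ba_structure =
  carrier :: "'a set"
  meet :: "'a \<Rightarrow> 'a \<Rightarrow> 'a"
  join :: "'a \<Rightarrow> 'a \<Rightarrow> 'a"
  zero :: 'a
  one :: 'a

text \<open>Well-formedness; the universe is nonempty because it contains the constants.\<close>

definition is_structure :: "'a ba_structure \<Rightarrow> bool" where
  "is_structure M \<longleftrightarrow>
     zero M \<in> carrier M \<and> one M \<in> carrier M \<and>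
     (\<forall>x\<in>carrier M. \<forall>y\<in>carrier M. meet M x y \<in> carrier M \<and> join M x y \<in> carrier M)"

fun tm_val :: "'a ba_structure \<Rightarrow> (nat \<Rightarrow> 'a) \<Rightarrow> tm \<Rightarrow> 'a" where
  "tm_val M e (Var v) = e v"
| "tm_val M e Zero = zero M"
| "tm_val M e One = one M"
| "tm_val M e (Meet s t) = meet M (tm_val M e s) (tm_val M e t)"
| "tm_val M e (Join s t) = join M (tm_val M e s) (tm_val M e t)"

fun sat :: "'a ba_structure \<Rightarrow> (nat \<Rightarrow> 'a) \<Rightarrow> fm \<Rightarrow> bool" where
  "sat M e (Eq s t) \<longleftrightarrow> tm_val M e s = tm_val M e t"
| "sat M e (Neg p) \<longleftrightarrow> \<not> sat M e p"
| "sat M e (Conj p q) \<longleftrightarrow> sat M e p \<and> sat M e q"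
| "sat M e (Ex v p) \<longleftrightarrow> (\<exists>a\<in>carrier M. sat M (e(v := a)) p)"

definition is_model :: "'a ba_structure \<Rightarrow> fm set \<Rightarrow> bool" where
  "is_model M T \<longleftrightarrow>
     is_structure M \<and> (\<forall>p\<in>T. \<forall>e. range e \<subseteq> carrier M \<longrightarrow> sat M e p)"


section \<open>Monster models\<close>

text \<open>
  An instance \<open>\<phi>(x, a)\<close> of a formula with parameters is a pair \<open>(\<phi>, e)\<close> together with a set
  \<open>V\<close> of variables: those in \<open>V\<close> form the tuple \<open>x\<close>, and the other free variables of \<open>\<phi>\<close>
  are parameter variables, with \<open>e\<close> giving the parameters.  The values of \<open>e\<close> on \<open>V\<close> and off
  the free variables of \<open>\<phi>\<close> are irrelevant.  As usual inside a monster model, a (small) set of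
  instances is consistent when a single tuple \<open>x\<close> of the model satisfies all of them.
\<close>

definition consistent :: "'a ba_structure \<Rightarrow> nat set \<Rightarrow> (fm \<times> (nat \<Rightarrow> 'a)) set \<Rightarrow> bool" where
  "consistent M V P \<longleftrightarrow>
     (\<exists>b. range b \<subseteq> carrier M \<and> (\<forall>(p, e)\<in>P. sat M (override_on e b V) p))"

text \<open>Every finitely satisfiable 1-type over fewer than \<open>\<kappa>\<close> parameters is realized.\<close>

definition saturated :: "'k rel \<Rightarrow> 'a ba_structure \<Rightarrow> bool" where
  "saturated \<kappa> M \<longleftrightarrow>
     (\<forall>A P. A \<subseteq> carrier M \<longrightarrow> |A| <o \<kappa> \<longrightarrow>
        (\<forall>(p, e)\<in>P. range e \<subseteq> carrier M \<and> e ` (fv p - {0}) \<subseteq> A) \<longrightarrow>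
        (\<forall>Q. Q \<subseteq> P \<longrightarrow> finite Q \<longrightarrow> consistent M {0} Q) \<longrightarrow>
        consistent M {0} P)"

definition partial_elementary :: "'a ba_structure \<Rightarrow> 'a set \<Rightarrow> ('a \<Rightarrow> 'a) \<Rightarrow> bool" where
  "partial_elementary M A f \<longleftrightarrow>
     A \<subseteq> carrier M \<and> f ` A \<subseteq> carrier M \<and>
     (\<forall>p e. range e \<subseteq> A \<longrightarrow> (sat M e p \<longleftrightarrow> sat M (f \<circ> e) p))"

definition automorphism :: "'a ba_structure \<Rightarrow> ('a \<Rightarrow> 'a) \<Rightarrow> bool" where
  "automorphism M g \<longleftrightarrow>
     bij_betw g (carrier M) (carrier M) \<and> g (zero M) = zero M \<and> g (one M) = one M \<and>
     (\<forall>x\<in>carrier M. \<forall>y\<in>carrier M.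
        g (meet M x y) = meet M (g x) (g y) \<and> g (join M x y) = join M (g x) (g y))"

definition strongly_homogeneous :: "'k rel \<Rightarrow> 'a ba_structure \<Rightarrow> bool" where
  "strongly_homogeneous \<kappa> M \<longleftrightarrow>
     (\<forall>A f. |A| <o \<kappa> \<longrightarrow> partial_elementary M A f \<longrightarrow>
        (\<exists>g. automorphism M g \<and> (\<forall>a\<in>A. g a = f a)))"

text \<open>
  The cardinal \<open>\<kappa>\<close> bounds the notion of smallness.  It is only required to exceed the
  cardinality of the language, which is also that of the index set of the trees below.
\<close>

definition monster_model :: "'k rel \<Rightarrow> fm set \<Rightarrow> 'a ba_structure \<Rightarrow> bool" where
  "monster_model \<kappa> T M \<longleftrightarrow>
     Card_order \<kappa> \<and> |UNIV :: nat set| <o \<kappa> \<and>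
     is_model M T \<and> saturated \<kappa> M \<and> strongly_homogeneous \<kappa> M"


section \<open>The antichain tree property\<close>

text \<open>
  Nodes of the binary tree are Boolean lists ordered by \<open>prefix\<close>.  These notions are meant
  for a monster model \<open>M\<close> of the complete theory under consideration.
\<close>

definition formula_has_ATP :: "'a ba_structure \<Rightarrow> fm \<Rightarrow> nat set \<Rightarrow> bool" where
  "formula_has_ATP M \<phi> V \<longleftrightarrow>
     (\<exists>a :: bool list \<Rightarrow> nat \<Rightarrow> 'a.
        (\<forall>\<eta>. range (a \<eta>) \<subseteq> carrier M) \<and>
        (\<forall>X. pairwise (\<parallel>) X \<longrightarrow> consistent M V {(\<phi>, a \<eta>) | \<eta>. \<eta> \<in> X}) \<and>
        (\<forall>\<eta> \<nu>. prefix \<eta> \<nu> \<longrightarrow> \<eta> \<noteq> \<nu> \<longrightarrow> \<not> consistent M V {(\<phi>, a \<eta>), (\<phi>, a \<nu>)}))"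

definition has_ATP :: "'a ba_structure \<Rightarrow> bool" where
  "has_ATP M \<longleftrightarrow> (\<exists>\<phi> V. finite V \<and> formula_has_ATP M \<phi> V)"


section \<open>Atomless Boolean algebras\<close>

definition boolean_algebra_axioms :: "fm set" where
  "boolean_algebra_axioms =
    (let x = Var 0; y = Var 1; z = Var 2 in
     {All 0 (All 1 (Eq (Meet x y) (Meet y x))),
      All 0 (All 1 (Eq (Join x y) (Join y x))),
      All 0 (All 1 (All 2 (Eq (Meet x (Meet y z)) (Meet (Meet x y) z)))),
      All 0 (All 1 (All 2 (Eq (Join x (Join y z)) (Join (Join x y) z)))),
      All 0 (All 1 (Eq (Meet x (Join x y)) x)),
      All 0 (All 1 (Eq (Join x (Meet x y)) x)),
      All 0 (All 1 (All 2 (Eq (Meet x (Join y z)) (Join (Meet x y) (Meet x z))))),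
      All 0 (All 1 (All 2 (Eq (Join x (Meet y z)) (Meet (Join x y) (Join x z))))),
      All 0 (Eq (Meet x One) x),
      All 0 (Eq (Join x Zero) x),
      All 0 (Ex 1 (Conj (Eq (Meet x y) Zero) (Eq (Join x y) One))),
      Neg (Eq Zero One)})"

definition atomless_axiom :: fm where
  "atomless_axiom =
    (let x = Var 0; y = Var 1 in
     All 0 (Imp (Neg (Eq x Zero))
       (Ex 1 (Conj (Neg (Eq y Zero)) (Conj (Le y x) (Neg (Eq y x)))))))"

definition atomless_boolean_algebras :: "fm set" where
  "atomless_boolean_algebras = insert atomless_axiom boolean_algebra_axioms"

end

(* The witnessing formula is x /\ y = z.  In an atomless Boolean algebra there is a binary tree of
   nonzero elements d(h) in which the children of h are disjoint and their join a(h) is strictly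
   below d(h).  The instance of the formula at h says x /\ d(h) = a(h).  If n properly extends h,
   then d(n) <= a(h) <= x, so x /\ d(n) = d(n), which differs from a(n).  For a finite antichain the
   join of the a(h) is a solution, since incomparable nodes carry disjoint elements; saturation
   gives the infinite antichains. *)
theory Submission
  imports Defs "HOL-Library.Countable_Set"
begin

text \<open>The axioms in semantic form, relativized to \<open>carrier M\<close>, so that the rest
  is plain algebra. The language has no symbol for complements, so they appear only as an existence
  statement.\<close>

locale atomless_boolean_structure =
  fixes M :: "'a ba_structure"
  assumes zero_closed [simp]: "zero M \<in> carrier M"
    and one_closed [simp]: "one M \<in> carrier M"
    and meet_closed [simp]: "\<lbrakk>x \<in> carrier M; y \<in> carrier M\<rbrakk> \<Longrightarrow> meet M x y \<in> carrier M"
    and join_closed [simp]: "\<lbrakk>x \<in> carrier M; y \<in> carrier M\<rbrakk> \<Longrightarrow> join M x y \<in> carrier M"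
    and meet_comm: "\<lbrakk>x \<in> carrier M; y \<in> carrier M\<rbrakk> \<Longrightarrow> meet M x y = meet M y x"
    and join_comm: "\<lbrakk>x \<in> carrier M; y \<in> carrier M\<rbrakk> \<Longrightarrow> join M x y = join M y x"
    and meet_assoc: "\<lbrakk>x \<in> carrier M; y \<in> carrier M; z \<in> carrier M\<rbrakk>
      \<Longrightarrow> meet M x (meet M y z) = meet M (meet M x y) z"
    and meet_join_absorb: "\<lbrakk>x \<in> carrier M; y \<in> carrier M\<rbrakk> \<Longrightarrow> meet M x (join M x y) = x"
    and meet_join_distrib: "\<lbrakk>x \<in> carrier M; y \<in> carrier M; z \<in> carrier M\<rbrakk>
      \<Longrightarrow> meet M x (join M y z) = join M (meet M x y) (meet M x z)"
    and meet_one [simp]: "x \<in> carrier M \<Longrightarrow> meet M x (one M) = x"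
    and join_zero [simp]: "x \<in> carrier M \<Longrightarrow> join M x (zero M) = x"
    and complement_exists: "x \<in> carrier M
      \<Longrightarrow> \<exists>y\<in>carrier M. meet M x y = zero M \<and> join M x y = one M"
    and zero_neq_one: "zero M \<noteq> one M"
    and atomless: "\<lbrakk>x \<in> carrier M; x \<noteq> zero M\<rbrakk>
      \<Longrightarrow> \<exists>y\<in>carrier M. y \<noteq> zero M \<and> meet M y x = y \<and> y \<noteq> x"
begin

lemma meet_idem: "x \<in> carrier M \<Longrightarrow> meet M x x = x"
  using meet_join_absorb[of x "zero M"] by simp

lemma zero_join [simp]: "x \<in> carrier M \<Longrightarrow> join M (zero M) x = x"
  using join_comm[of "zero M" x] by simp

lemma zero_meet [simp]: "x \<in> carrier M \<Longrightarrow> meet M (zero M) x = zero M"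
  using meet_join_absorb[of "zero M" x] by simp

lemma meet_zero [simp]: "x \<in> carrier M \<Longrightarrow> meet M x (zero M) = zero M"
  using meet_comm[of x "zero M"] by simp

lemma join_meet_distrib:
  "\<lbrakk>x \<in> carrier M; y \<in> carrier M; z \<in> carrier M\<rbrakk>
    \<Longrightarrow> meet M (join M x y) z = join M (meet M x z) (meet M y z)"
  by (simp add: meet_comm[of _ z] meet_join_distrib)

text \<open>Throughout, the order is kept as the equation \<open>meet M x y = x\<close>, as in the
  formula \<open>Le\<close>.\<close>

lemma below_trans:
  assumes "x \<in> carrier M" "y \<in> carrier M" "z \<in> carrier M"
    and "meet M x y = x" "meet M y z = y"
  shows "meet M x z = x"
  by (metis assms meet_assoc)

lemma disjoint_below:
  assumes "x \<in> carrier M" "y \<in> carrier M" "x' \<in> carrier M" "y' \<in> carrier M"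
    and "meet M x' x = x'" "meet M y' y = y'" "meet M x y = zero M"
  shows "meet M x' y' = zero M"
proof -
  have "meet M x' y = zero M"
    using assms by (metis meet_assoc meet_zero)
  then show ?thesis
    using assms by (metis meet_assoc meet_comm meet_zero)
qed

text \<open>Atomlessness is used twice, for nonzero elements v < y < u. With w the complement of y
  relative to u, the part of y outside v is missed by both v and w, so their join stays strictly
  below u.\<close>

lemma split_with_remainder:
  assumes u: "u \<in> carrier M" "u \<noteq> zero M"
  obtains v w where "v \<in> carrier M" "w \<in> carrier M" "v \<noteq> zero M" "w \<noteq> zero M"
    "meet M v u = v" "meet M w u = w" "meet M v w = zero M" "join M v w \<noteq> u"
proof -
  obtain y where y: "y \<in> carrier M" "y \<noteq> zero M" "meet M y u = y" "y \<noteq> u"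
    using atomless u by blast
  obtain c where c: "c \<in> carrier M" "meet M y c = zero M" "join M y c = one M"
    using complement_exists y by blast
  obtain v where v: "v \<in> carrier M" "v \<noteq> zero M" "meet M v y = v" "v \<noteq> y"
    using atomless y by blast
  define w where "w = meet M c u"
  have w: "w \<in> carrier M" "meet M w u = w"
    using c u meet_assoc[of c u u] by (simp_all add: w_def meet_idem)
  have yw: "meet M y w = zero M"
    using c u y by (simp add: w_def meet_assoc)
  have "u = meet M (join M y c) u"
    using c u meet_comm[of "one M" u] by simp
  then have u_eq: "u = join M y w"
    using c(1) u y join_meet_distrib[of y c u] unfolding c(3) by (simp add: w_def)
  \<comment> \<open>If w were zero, \<open>u_eq\<close> would give u = y.\<close>
  have "w \<noteq> zero M"
    using u_eq y by auto
  moreover have "meet M v u = v"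
    using below_trans u v y by blast
  moreover have "meet M v w = zero M"
    using disjoint_below[of y w v w] v w y yw by (simp add: meet_idem)
  moreover have "join M v w \<noteq> u"
  proof
    assume "join M v w = u"
    \<comment> \<open>Meeting with y removes w and keeps v, so the join can be u only if v =
      y.\<close>
    then have "y = meet M y (join M v w)"
      using y by simp
    also have "\<dots> = v"
      using v w y yw by (simp add: meet_join_distrib meet_comm[of y v])
    finally show False
      using v by simp
  qed
  ultimately show ?thesis
    using that v w by blast
qed

lemma binary_tree_with_remainders:
  obtains d :: "bool list \<Rightarrow> 'a" where
    "\<And>\<eta>. d \<eta> \<in> carrier M" "\<And>\<eta>. d \<eta> \<noteq> zero M"
    "\<And>\<eta> i. meet M (d (\<eta> @ [i])) (d \<eta>) = d (\<eta> @ [i])"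
    "\<And>\<eta>. meet M (d (\<eta> @ [True])) (d (\<eta> @ [False])) = zero M"
    "\<And>\<eta>. join M (d (\<eta> @ [True])) (d (\<eta> @ [False])) \<noteq> d \<eta>"
proof -
  let ?N = "carrier M - {zero M}"
  \<comment> \<open>The two parts are packed into one pair, so that a single choice function s
    yields both children of u at once.\<close>
  have "\<forall>u\<in>?N. \<exists>p. fst p \<in> ?N \<and> snd p \<in> ?N \<and> meet M (fst p) u = fst p \<and>
      meet M (snd p) u = snd p \<and> meet M (fst p) (snd p) = zero M \<and> join M (fst p) (snd p) \<noteq> u"
    by (metis Diff_iff fst_conv singletonD singletonI snd_conv split_with_remainder)
  then obtain s where s: "\<And>u. u \<in> ?N \<Longrightarrow> fst (s u) \<in> ?N \<and> snd (s u) \<in> ?N \<and>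
      meet M (fst (s u)) u = fst (s u) \<and> meet M (snd (s u)) u = snd (s u) \<and>
      meet M (fst (s u)) (snd (s u)) = zero M \<and> join M (fst (s u)) (snd (s u)) \<noteq> u"
    by metis
  \<comment> \<open>The root is \<open>one M\<close>, nonzero by nontriviality. \<open>fold\<close>
    reads the path from the left, so appending a bit at the end performs one more split.\<close>
  define d where "d \<eta> = fold (\<lambda>i u. if i then fst (s u) else snd (s u)) \<eta> (one M)" for \<eta>
  have d_snoc: "d (\<eta> @ [i]) = (if i then fst (s (d \<eta>)) else snd (s (d \<eta>)))" for \<eta> i
    by (simp add: d_def)
  have d: "d \<eta> \<in> ?N" for \<eta>
  proof (induction \<eta> rule: rev_induct)
    case Nil
    then show ?case using zero_neq_one by (simp add: d_def)
  next
    case (snoc i \<eta>)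
    then show ?case using s[of "d \<eta>"] unfolding d_snoc by auto
  qed
  show ?thesis
    by (rule that[of d]) (use d s[OF d] in \<open>auto simp: d_snoc\<close>)
qed

end

lemma atomless_boolean_structureI:
  assumes "is_model M atomless_boolean_algebras"
  shows "atomless_boolean_structure M"
proof -
  have wf: "is_structure M"
    using assms by (simp add: is_model_def)
  \<comment> \<open>The axioms are sentences, so evaluating them at a single assignment, here the
    constant zero, gives their full content.\<close>
  have "\<forall>p\<in>atomless_boolean_algebras. sat M (\<lambda>_. zero M) p"
    using assms by (auto simp: is_model_def is_structure_def)
  note axs = this[unfolded atomless_boolean_algebras_def boolean_algebra_axioms_def
      atomless_axiom_def Let_def, simplified]
  show ?thesis
    by unfold_locales (use wf[unfolded is_structure_def] axs in metis)+
qed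

text \<open>The tuple x is the single variable 0, so the antichain condition asks for the
  realization of a 1-type over countably many parameters, which is what saturation provides.\<close>

lemma has_ATP_if_saturated:
  fixes M :: "'a ba_structure" and \<kappa> :: "'k rel"
  assumes "atomless_boolean_structure M" "saturated \<kappa> M" "|UNIV :: nat set| <o \<kappa>"
  shows "has_ATP M"
proof -
  interpret atomless_boolean_structure M by fact
  obtain d :: "bool list \<Rightarrow> 'a" where
    d_closed [simp]: "\<And>\<eta>. d \<eta> \<in> carrier M" and d_nonzero: "\<And>\<eta>. d \<eta> \<noteq> zero M"
    and d_child: "\<And>\<eta> i. meet M (d (\<eta> @ [i])) (d \<eta>) = d (\<eta> @ [i])"
    and d_disj: "\<And>\<eta>. meet M (d (\<eta> @ [True])) (d (\<eta> @ [False])) = zero M"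
    and d_strict: "\<And>\<eta>. join M (d (\<eta> @ [True])) (d (\<eta> @ [False])) \<noteq> d \<eta>"
    by (rule binary_tree_with_remainders) (rule that)
  define a where "a \<eta> = join M (d (\<eta> @ [True])) (d (\<eta> @ [False]))" for \<eta>
  have a_closed [simp]: "a \<eta> \<in> carrier M" for \<eta>
    by (simp add: a_def)
  have a_below: "meet M (a \<eta>) (d \<eta>) = a \<eta>" for \<eta>
    by (simp add: a_def join_meet_distrib d_child)
  have d_mono: "meet M (d (\<eta> @ \<nu>)) (d \<eta>) = d (\<eta> @ \<nu>)" for \<eta> \<nu>
  proof (induction \<nu> rule: rev_induct)
    case Nil
    then show ?case by (simp add: meet_idem)
  next
    case (snoc i \<nu>)
    then show ?case
      using below_trans[of "d (\<eta> @ \<nu> @ [i])" "d (\<eta> @ \<nu>)" "d \<eta>"] d_child[of "\<eta> @ \<nu>" i] by simp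
  qed
  have d_parallel: "meet M (d \<eta>) (d \<nu>) = zero M" if parallel: "\<eta> \<parallel> \<nu>" for \<eta> \<nu>
  proof -
    \<comment> \<open>The two nodes branch at \<rho>, so their elements lie below different children
      of \<rho>, which are disjoint.\<close>
    obtain \<rho> i \<eta>' j \<nu>' where "i \<noteq> j" and eq: "\<eta> = \<rho> @ i # \<eta>'" "\<nu> = \<rho> @ j # \<nu>'"
      using parallel_decomp[OF parallel] by blast
    have "meet M (d (\<rho> @ [i])) (d (\<rho> @ [j])) = zero M"
      using \<open>i \<noteq> j\<close> d_disj[of \<rho>] meet_comm[of "d (\<rho> @ [i])" "d (\<rho> @ [j])"]
      by (cases i; cases j) auto
    moreover have "meet M (d \<eta>) (d (\<rho> @ [i])) = d \<eta>" "meet M (d \<nu>) (d (\<rho> @ [j])) = d \<nu>"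
      using d_mono[of "\<rho> @ [i]" \<eta>'] d_mono[of "\<rho> @ [j]" \<nu>'] eq by simp_all
    ultimately show ?thesis
      using disjoint_below d_closed by blast
  qed
  have a_parallel: "meet M (a \<eta>) (d \<nu>) = zero M" if "\<eta> \<parallel> \<nu>" for \<eta> \<nu>
    using disjoint_below[of "d \<eta>" "d \<nu>" "a \<eta>" "d \<nu>"] a_below d_parallel[OF that]
    by (simp add: meet_idem)

  \<comment> \<open>The second clause strengthens the induction: the old witness b must vanish on
    \<open>d \<eta>\<close> for the new node \<eta>. Then in \<open>join M b (a \<eta>)\<close> only
    \<open>a \<eta>\<close> counts at \<eta>, and only b counts at the old nodes.\<close>
  have finite_antichain: "\<exists>b\<in>carrier M. (\<forall>\<eta>\<in>F. meet M b (d \<eta>) = a \<eta>) \<and>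
      (\<forall>\<nu>. (\<forall>\<eta>\<in>F. \<eta> \<parallel> \<nu>) \<longrightarrow> meet M b (d \<nu>) = zero M)"
    if "finite F" "pairwise (\<parallel>) F" for F
    using that
  proof (induction F rule: finite_induct)
    case empty
    then show ?case by (intro bexI[of _ "zero M"]) simp_all
  next
    case (insert \<eta> F)
    have F: "pairwise (\<parallel>) F" and \<eta>: "\<And>\<nu>. \<nu> \<in> F \<Longrightarrow> \<eta> \<parallel> \<nu> \<and> \<nu> \<parallel> \<eta>"
      using insert.prems insert.hyps by (auto simp: pairwise_insert)
    obtain b where b: "b \<in> carrier M" "\<And>\<nu>. \<nu> \<in> F \<Longrightarrow> meet M b (d \<nu>) = a \<nu>"
      "\<And>\<nu>. \<forall>\<eta>\<in>F. \<eta> \<parallel> \<nu> \<Longrightarrow> meet M b (d \<nu>) = zero M"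
      using insert.IH[OF F] by blast
    show ?case
      by (rule bexI[of _ "join M b (a \<eta>)"])
        (use b \<eta> in \<open>auto simp: join_meet_distrib a_below a_parallel\<close>)
  qed

  define \<phi> where "\<phi> = Eq (Meet (Var 0) (Var 1)) (Var 2)"
  \<comment> \<open>Position 1 carries \<open>d \<eta>\<close> and position 2 carries
    \<open>a \<eta>\<close>; the same value elsewhere keeps the assignment inside the
    carrier.\<close>
  define e where "e \<eta> n = (if n = 1 then d \<eta> else a \<eta>)" for \<eta> and n :: nat
  have e_closed: "range (e \<eta>) \<subseteq> carrier M" for \<eta>
    by (auto simp: e_def)
  have sat_iff: "sat M (override_on (e \<eta>) b {0}) \<phi> \<longleftrightarrow> meet M (b 0) (d \<eta>) = a \<eta>" for b \<eta>
    by (simp add: \<phi>_def e_def)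
  have consistent_iff: "consistent M {0} {(\<phi>, e \<eta>) | \<eta>. \<eta> \<in> X} \<longleftrightarrow>
      (\<exists>b\<in>carrier M. \<forall>\<eta>\<in>X. meet M b (d \<eta>) = a \<eta>)" (is "?L \<longleftrightarrow> ?R") for X
  proof
    assume ?L
    then show ?R
      unfolding consistent_def by (force simp: sat_iff)
  next
    assume ?R
    then obtain b where "b \<in> carrier M" "\<forall>\<eta>\<in>X. meet M b (d \<eta>) = a \<eta>" by blast
    then show ?L
      unfolding consistent_def by (intro exI[of _ "\<lambda>_. b"]) (auto simp: sat_iff)
  qed

  have "consistent M {0} {(\<phi>, e \<eta>) | \<eta>. \<eta> \<in> X}" if X: "pairwise (\<parallel>) X" for X
  proof -
    \<comment> \<open>All parameters of the whole tree are collected. There are countably many nodes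
      and variables, so this set is smaller than \<open>\<kappa>\<close>.\<close>
    let ?A = "\<Union>\<eta>. range (e \<eta>)" and ?P = "{(\<phi>, e \<eta>) | \<eta>. \<eta> \<in> X}"
    have "countable ?A"
      by simp
    then have "|?A| \<le>o |UNIV :: nat set|"
      by (auto simp: countable_def simp flip: card_of_ordLeq)
    then have small: "|?A| <o \<kappa>"
      using assms(3) ordLeq_ordLess_trans by blast
    have fin: "consistent M {0} Q" if Q: "Q \<subseteq> ?P" "finite Q" for Q
    proof -
      \<comment> \<open>Finitely many instances come from finitely many nodes of X, and these again
        form an antichain.\<close>
      have "Q \<subseteq> (\<lambda>\<eta>. (\<phi>, e \<eta>)) ` X"
        using Q by auto
      then obtain F where F: "F \<subseteq> X" "finite F" "Q = (\<lambda>\<eta>. (\<phi>, e \<eta>)) ` F"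
        using finite_subset_image[OF \<open>finite Q\<close>] by blast
      then have "Q = {(\<phi>, e \<eta>) | \<eta>. \<eta> \<in> F}"
        by auto
      then show ?thesis
        using finite_antichain[OF \<open>finite F\<close> pairwise_subset[OF X \<open>F \<subseteq> X\<close>]] consistent_iff by auto
    qed
    have "?A \<subseteq> carrier M"
      using e_closed by blast
    moreover have "\<forall>(p, f)\<in>?P. range f \<subseteq> carrier M \<and> f ` (fv p - {0}) \<subseteq> ?A"
      using e_closed by blast
    ultimately show ?thesis
      using assms(2)[unfolded saturated_def, THEN spec[of _ ?A], THEN spec[of _ ?P]] small fin
      by (elim impE) blast+
  qed
  moreover have "\<not> consistent M {0} {(\<phi>, e \<eta>), (\<phi>, e \<nu>)}"
    if strict: "prefix \<eta> \<nu>" "\<eta> \<noteq> \<nu>" for \<eta> \<nu>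
  proof
    assume "consistent M {0} {(\<phi>, e \<eta>), (\<phi>, e \<nu>)}"
    \<comment> \<open>\<open>consistent_iff\<close> holds for any set of nodes, so it also applies
      to this comparable pair.\<close>
    moreover have "{(\<phi>, e \<eta>), (\<phi>, e \<nu>)} = {(\<phi>, e \<rho>) | \<rho>. \<rho> \<in> {\<eta>, \<nu>}}"
      by auto
    ultimately obtain b where b: "b \<in> carrier M" "meet M b (d \<eta>) = a \<eta>" "meet M b (d \<nu>) = a \<nu>"
      using consistent_iff[of "{\<eta>, \<nu>}"] by auto
    obtain i \<nu>' where \<nu>: "\<nu> = \<eta> @ i # \<nu>'"
      using strict by (metis append_Nil2 neq_Nil_conv prefixE)
    \<comment> \<open>The child of \<eta> towards \<nu> is one of the two elements joined in
      \<open>a \<eta>\<close>, so absorption applies.\<close>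
    have "meet M (d (\<eta> @ [i])) (a \<eta>) = d (\<eta> @ [i])"
      using meet_join_absorb[of "d (\<eta> @ [True])" "d (\<eta> @ [False])"]
        meet_join_absorb[of "d (\<eta> @ [False])" "d (\<eta> @ [True])"]
        join_comm[of "d (\<eta> @ [True])" "d (\<eta> @ [False])"]
      by (cases i) (simp_all add: a_def)
    then have "meet M (d \<nu>) (a \<eta>) = d \<nu>"
      using below_trans[of "d \<nu>" "d (\<eta> @ [i])" "a \<eta>"] d_mono[of "\<eta> @ [i]" \<nu>'] \<nu> by simp
    \<comment> \<open>Being the meet of b with \<open>d \<eta>\<close>, the element
      \<open>a \<eta>\<close> lies below b.\<close>
    moreover have "meet M (a \<eta>) b = a \<eta>"
      using b by (metis d_closed meet_assoc meet_comm meet_idem)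
    ultimately have "meet M (d \<nu>) b = d \<nu>"
      using below_trans[of "d \<nu>" "a \<eta>" b] b by simp
    then have "a \<nu> = d \<nu>"
      using b meet_comm[of b "d \<nu>"] by simp
    then show False
      using d_strict by (simp add: a_def)
  qed
  ultimately have "formula_has_ATP M \<phi> {0}"
    unfolding formula_has_ATP_def using e_closed by blast
  then show ?thesis
    unfolding has_ATP_def by blast
qed

theorem mainTheorem9:
  fixes M :: "'a ba_structure" and \<kappa> :: "'k rel"
  assumes "monster_model \<kappa> atomless_boolean_algebras M"
  shows "has_ATP M"
  using assms has_ATP_if_saturated atomless_boolean_structureI
  unfolding monster_model_def by blast

end
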